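(* For every subgroup $H\subseteq G$, we have the following equalities of subsets of $\operatorname{Spec}R$ (where $H'$ ranges over subgroups of $G$ and all unions are disjoint): $$V(I_H)=\bigsqcup_{H'\not\supseteq H}\gamma(H'),\qquad V(I_H^* )=\bigsqcup_{H'\text{ not properly containing }H}\gamma(H'),$$ $$V(J_H)=\bigsqcup_{H'\subsetneq H}\gamma(H'),\qquad V(J_H^* )=\bigsqcup_{H'\subseteq H}\gamma(H').$$
   Context: Setup: $G$ is a finite group, $D$ is a nonempty set of nontrivial conjugacy classes of $G$, $\xi:D\to\mathbb{Z}_{>0}$ is a map, $|\xi|=\sum_{\gamma\in D}\xi(\gamma)$, and $k$ is a field whose characteristic does not divide $|G|$. The Artin braid group $\mathrm{B}_n$ (standard generators $\sigma_1,\dots,\sigma_{n-1}$) acts on $G^n$ by the Hurwitz action: $\sigma_i$ replaces the entries $(g_i,g_{i+1})$ in positions $i,i+1$ by $(g_ig_{i+1}g_i^{-1},g_i)$ and fixes the other entries. The product $g_1\cdots g_n$ and the subgroup $\langle g_1,\dots,g_n\rangle$ of $G$ are invariant under this action. A component of degree $n$ is an orbit, under $\mathrm{B}_{n|\xi|}$, of a tuple $(g_1,\dots,g_{n|\xi|})\in G^{n|\xi|}$ with $g_1\cdots g_{n|\xi|}=1$ and such that exactly $n\,\xi(\gamma)$ entries belong to $\gamma$, for each $\gamma\in D$. The group $\langle m\rangle$ of a component $m$ is the subgroup of $G$ generated by the entries of a representing tuple. Components of all degrees $n\ge 0$ form, under concatenation, a commutative finitely generated graded monoid $\mathrm{Comp}$,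 with identity the orbit of the empty tuple. The ring of components is the monoid ring $R=k[\mathrm{Comp}]$, a finitely generated commutative graded $k$-algebra. For a subgroup $H\subseteq G$, define the following homogeneous ideals of $R$: $I_H$ (resp. $I_H^*$, $J_H$, $J_H^*$) is spanned over $k$ by the components whose group contains $H$ (resp. properly contains $H$, is not properly contained in $H$, is not contained in $H$). For an ideal $I$ of $R$, $V(I)\subseteq\operatorname{Spec}R$ is the closed set of prime ideals containing $I$. The stratum associated to $H$ is $\gamma(H)=V(I_H^* )\setminus V(I_H)$. *)

theory Defs
  imports "HOL-Algebra.Algebra" "HOL-Library.Poly_Mapping" "HOL-Library.Disjoint_Sets"
begin

section \<open>The Artin braid group\<close>

text \<open>
  A letter \<open>(i, True)\<close> stands for the generator \<open>\<sigma>\<^sub>i\<close> and \<open>(i, False)\<close> for its inverse.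
  Positions are counted from \<open>0\<close>, so the generators of the braid group on \<open>n\<close> strands
  are the \<open>\<sigma>\<^sub>i\<close> with \<open>Suc i < n\<close>.
\<close>

type_synonym braid_word = "(nat \<times> bool) list"

definition braid_words :: "nat \<Rightarrow> braid_word set" where
  "braid_words n = lists ({i. Suc i < n} \<times> UNIV)"

inductive braid_eq :: "nat \<Rightarrow> braid_word \<Rightarrow> braid_word \<Rightarrow> bool" for n where
  refl: "w \<in> braid_words n \<Longrightarrow> braid_eq n w w"
| sym: "braid_eq n v w \<Longrightarrow> braid_eq n w v"
| trans: "braid_eq n u v \<Longrightarrow> braid_eq n v w \<Longrightarrow> braid_eq n u w"
| append: "braid_eq n u u' \<Longrightarrow> braid_eq n v v' \<Longrightarrow> braid_eq n (u @ v) (u' @ v')"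
| cancel: "Suc i < n \<Longrightarrow> braid_eq n [(i, e), (i, \<not> e)] []"
| far: "Suc i < j \<Longrightarrow> Suc j < n \<Longrightarrow>
    braid_eq n [(i, True), (j, True)] [(j, True), (i, True)]"
| braid: "Suc (Suc i) < n \<Longrightarrow>
    braid_eq n [(i, True), (Suc i, True), (i, True)] [(Suc i, True), (i, True), (Suc i, True)]"

definition braid_group :: "nat \<Rightarrow> braid_word set monoid" where
  "braid_group n =
    \<lparr>carrier = braid_words n // {(v, w). braid_eq n v w},
     monoid.mult = (\<lambda>A B. \<Union>v\<in>A. \<Union>w\<in>B. {u. braid_eq n (v @ w) u}),
     one = {u. braid_eq n [] u}\<rparr>"


section \<open>The Hurwitz action\<close>

definition tuples :: "('g, 'x) monoid_scheme \<Rightarrow> nat \<Rightarrow> 'g list set" where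
  "tuples G n = {gs. set gs \<subseteq> carrier G \<and> length gs = n}"

fun hurwitz_letter :: "('g, 'x) monoid_scheme \<Rightarrow> nat \<times> bool \<Rightarrow> 'g list \<Rightarrow> 'g list" where
  "hurwitz_letter G (i, True) gs =
     gs[i := gs ! i \<otimes>\<^bsub>G\<^esub> gs ! Suc i \<otimes>\<^bsub>G\<^esub> inv\<^bsub>G\<^esub> (gs ! i), Suc i := gs ! i]"
| "hurwitz_letter G (i, False) gs =
     gs[i := gs ! Suc i, Suc i := inv\<^bsub>G\<^esub> (gs ! Suc i) \<otimes>\<^bsub>G\<^esub> gs ! i \<otimes>\<^bsub>G\<^esub> gs ! Suc i]"

text \<open>
  The action of a braid is computed on any word representing it; the rightmost letter acts first.
  This does not depend on the word and is a group action (\<open>hurwitz_class\<close>, \<open>hurwitz_action\<close> below).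
\<close>

definition hurwitz ::
    "('g, 'x) monoid_scheme \<Rightarrow> nat \<Rightarrow> braid_word set \<Rightarrow> 'g list \<Rightarrow> 'g list" where
  "hurwitz G n \<beta> = (\<lambda>gs \<in> tuples G n. foldr (hurwitz_letter G) (SOME w. w \<in> \<beta>) gs)"

definition hurwitz_orbit :: "('g, 'x) monoid_scheme \<Rightarrow> 'g list \<Rightarrow> 'g list set" where
  "hurwitz_orbit G gs = orbit (braid_group (length gs)) (hurwitz G (length gs)) gs"


section \<open>The monoid of components\<close>

definition conjugacy_class :: "('g, 'x) monoid_scheme \<Rightarrow> 'g \<Rightarrow> 'g set" where
  "conjugacy_class G g = {h \<otimes>\<^bsub>G\<^esub> g \<otimes>\<^bsub>G\<^esub> inv\<^bsub>G\<^esub> h | h. h \<in> carrier G}"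

definition nontrivial_conjugacy_classes :: "('g, 'x) monoid_scheme \<Rightarrow> 'g set set" where
  "nontrivial_conjugacy_classes G = conjugacy_class G ` carrier G - {{\<one>\<^bsub>G\<^esub>}}"

definition tuple_prod :: "('g, 'x) monoid_scheme \<Rightarrow> 'g list \<Rightarrow> 'g" where
  "tuple_prod G gs = foldr (\<otimes>\<^bsub>G\<^esub>) gs \<one>\<^bsub>G\<^esub>"

definition components ::
    "('g, 'x) monoid_scheme \<Rightarrow> 'g set set \<Rightarrow> ('g set \<Rightarrow> nat) \<Rightarrow> nat \<Rightarrow> 'g list set set" where
  "components G D \<xi> n =
    {hurwitz_orbit G gs | gs. gs \<in> tuples G (n * (\<Sum>\<gamma>\<in>D. \<xi> \<gamma>)) \<and> tuple_prod G gs = \<one>\<^bsub>G\<^esub> \<and>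
       (\<forall>\<gamma>\<in>D. length (filter (\<lambda>g. g \<in> \<gamma>) gs) = n * \<xi> \<gamma>)}"

text \<open>All orbits in the union defining the product coincide (\<open>hurwitz_orbit_append\<close> below).\<close>

definition Comp ::
    "('g, 'x) monoid_scheme \<Rightarrow> 'g set set \<Rightarrow> ('g set \<Rightarrow> nat) \<Rightarrow> 'g list set monoid" where
  "Comp G D \<xi> =
    \<lparr>carrier = (\<Union>n. components G D \<xi> n),
     monoid.mult = (\<lambda>m m'. \<Union>gs\<in>m. \<Union>hs\<in>m'. hurwitz_orbit G (gs @ hs)),
     one = hurwitz_orbit G []\<rparr>"

text \<open>The subgroup does not depend on the chosen representing tuple (\<open>comp_group_orbit\<close> below).\<close>

definition comp_group :: "('g, 'x) monoid_scheme \<Rightarrow> 'g list set \<Rightarrow> 'g set" where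
  "comp_group G m = generate G (set (SOME gs. gs \<in> m))"


section \<open>The ring of components\<close>

definition monoid_ring :: "('m, 'x) monoid_scheme \<Rightarrow> ('m \<Rightarrow>\<^sub>0 'k::comm_ring_1) ring" where
  "monoid_ring M =
    \<lparr>carrier = {f. Poly_Mapping.keys f \<subseteq> carrier M},
     monoid.mult = (\<lambda>f f'. \<Sum>a\<in>Poly_Mapping.keys f. \<Sum>b\<in>Poly_Mapping.keys f'.
               Poly_Mapping.single (a \<otimes>\<^bsub>M\<^esub> b) (Poly_Mapping.lookup f a * Poly_Mapping.lookup f' b)),
     one = Poly_Mapping.single \<one>\<^bsub>M\<^esub> 1,
     ring.zero = 0,
     ring.add = (+)\<rparr>"

abbreviation ring_of_components ::
    "('g, 'x) monoid_scheme \<Rightarrow> 'g set set \<Rightarrow> ('g set \<Rightarrow> nat) \<Rightarrow> ('g list set \<Rightarrow>\<^sub>0 'k::field) ring" where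
  "ring_of_components G D \<xi> \<equiv> monoid_ring (Comp G D \<xi>)"

definition pm_scale :: "'k::field \<Rightarrow> ('m \<Rightarrow>\<^sub>0 'k) \<Rightarrow> ('m \<Rightarrow>\<^sub>0 'k)" where
  "pm_scale c f = Poly_Mapping.map ((*) c) f"

lemma lookup_pm_scale: "Poly_Mapping.lookup (pm_scale c f) a = c * Poly_Mapping.lookup f a"
  unfolding pm_scale_def by (transfer) (auto simp: when_def)

global_interpretation pm: vector_space "pm_scale :: 'k::field \<Rightarrow> ('m \<Rightarrow>\<^sub>0 'k) \<Rightarrow> ('m \<Rightarrow>\<^sub>0 'k)"
  by standard
    (auto intro!: poly_mapping_eqI simp: lookup_pm_scale lookup_add algebra_simps)

definition component_span ::
    "('g, 'x) monoid_scheme \<Rightarrow> 'g set set \<Rightarrow> ('g set \<Rightarrow> nat) \<Rightarrow> ('g set \<Rightarrow> bool)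
      \<Rightarrow> ('g list set \<Rightarrow>\<^sub>0 'k::field) set" where
  "component_span G D \<xi> P =
    pm.span {Poly_Mapping.single m 1 | m. m \<in> carrier (Comp G D \<xi>) \<and> P (comp_group G m)}"

definition ideal_I where "ideal_I G D \<xi> H = component_span G D \<xi> (\<lambda>K. H \<subseteq> K)"
definition ideal_I_star where "ideal_I_star G D \<xi> H = component_span G D \<xi> (\<lambda>K. H \<subset> K)"
definition ideal_J where "ideal_J G D \<xi> H = component_span G D \<xi> (\<lambda>K. \<not> K \<subset> H)"
definition ideal_J_star where "ideal_J_star G D \<xi> H = component_span G D \<xi> (\<lambda>K. \<not> K \<subseteq> H)"


section \<open>The spectrum and its strata\<close>

text \<open>
  The library's prime ideals live in commutative rings only; the ring of components is one by
  \<open>cring_ring_of_components\<close> below.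
\<close>

definition Spec :: "('a, 'x) ring_scheme \<Rightarrow> 'a set set" where
  "Spec R = {P. primeideal P R}"

definition zero_locus :: "('a, 'x) ring_scheme \<Rightarrow> 'a set \<Rightarrow> 'a set set" where
  "zero_locus R I = {P \<in> Spec R. I \<subseteq> P}"

definition stratum ::
    "('g, 'x) monoid_scheme \<Rightarrow> 'g set set \<Rightarrow> ('g set \<Rightarrow> nat) \<Rightarrow> 'g set
      \<Rightarrow> ('g list set \<Rightarrow>\<^sub>0 'k::field) set set" where
  "stratum G D \<xi> H =
    zero_locus (ring_of_components G D \<xi>) (ideal_I_star G D \<xi> H)
      - zero_locus (ring_of_components G D \<xi>) (ideal_I G D \<xi> H)"

definition is_disjoint_union :: "'a set \<Rightarrow> ('i \<Rightarrow> 'a set) \<Rightarrow> 'i set \<Rightarrow> bool" where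
  "is_disjoint_union U A I \<longleftrightarrow> U = (\<Union>i\<in>I. A i) \<and> disjoint_family_on A I"


section \<open>The constructions are well defined\<close>

lemma braid_words_simps [simp]:
  "[] \<in> braid_words n"
  "(i, e) # w \<in> braid_words n \<longleftrightarrow> Suc i < n \<and> w \<in> braid_words n"
  "v @ w \<in> braid_words n \<longleftrightarrow> v \<in> braid_words n \<and> w \<in> braid_words n"
  by (auto simp: braid_words_def)

lemma braid_eq_words: "braid_eq n v w \<Longrightarrow> v \<in> braid_words n \<and> w \<in> braid_words n"
  by (induction rule: braid_eq.induct) auto

definition braid_class :: "nat \<Rightarrow> braid_word \<Rightarrow> braid_word set" where
  "braid_class n w = {u. braid_eq n w u}"

lemma braid_class_eq_iff:
  assumes "v \<in> braid_words n"
  shows "braid_class n v = braid_class n w \<longleftrightarrow> braid_eq n v w"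
  using assms unfolding braid_class_def
  by (auto intro: braid_eq.intros)

lemma carrier_braid_group: "carrier (braid_group n) = braid_class n ` braid_words n"
  by (auto simp: braid_group_def braid_class_def quotient_def)

lemma one_braid_group: "\<one>\<^bsub>braid_group n\<^esub> = braid_class n []"
  by (simp add: braid_group_def braid_class_def)

lemma mult_braid_class:
  assumes "v \<in> braid_words n" "w \<in> braid_words n"
  shows "braid_class n v \<otimes>\<^bsub>braid_group n\<^esub> braid_class n w = braid_class n (v @ w)"
proof -
  have "(\<Union>v'\<in>braid_class n v. \<Union>w'\<in>braid_class n w. braid_class n (v' @ w')) = braid_class n (v @ w)"
    (is "?L = ?R")
  proof
    show "?L \<subseteq> ?R" unfolding braid_class_def by (blast intro: braid_eq.append braid_eq.trans)
    show "?R \<subseteq> ?L" unfolding braid_class_def using assms by (blast intro: braid_eq.refl)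
  qed
  then show ?thesis by (simp add: braid_group_def braid_class_def)
qed

fun braid_word_inv :: "braid_word \<Rightarrow> braid_word" where
  "braid_word_inv [] = []"
| "braid_word_inv ((i, e) # w) = braid_word_inv w @ [(i, \<not> e)]"

lemma braid_word_inv_words: "w \<in> braid_words n \<Longrightarrow> braid_word_inv w \<in> braid_words n"
  by (induction w rule: braid_word_inv.induct) auto

lemma braid_word_inv: "w \<in> braid_words n \<Longrightarrow> braid_eq n (braid_word_inv w @ w) []"
proof (induction w rule: braid_word_inv.induct)
  case 1
  show ?case by (auto intro: braid_eq.refl)
next
  case (2 i e w)
  then have w: "w \<in> braid_words n" "Suc i < n" by auto
  have "braid_eq n ([(i, \<not> e), (i, e)] @ w) ([] @ w)"
    by (rule braid_eq.append) (use w braid_eq.cancel[of i n "\<not> e"] in \<open>auto intro: braid_eq.refl\<close>)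
  then have "braid_eq n (braid_word_inv w @ ([(i, \<not> e), (i, e)] @ w)) (braid_word_inv w @ ([] @ w))"
    using w braid_word_inv_words by (blast intro: braid_eq.append braid_eq.refl)
  with 2 w show ?case by (auto intro: braid_eq.trans)
qed

theorem group_braid_group: "group (braid_group n)"
proof (rule groupI, goal_cases)
  case (5 x)
  then obtain w where w: "w \<in> braid_words n" "x = braid_class n w" by (auto simp: carrier_braid_group)
  then have "braid_class n (braid_word_inv w) \<otimes>\<^bsub>braid_group n\<^esub> x = \<one>\<^bsub>braid_group n\<^esub>"
    using braid_word_inv[OF w(1)] by (simp add: mult_braid_class braid_word_inv_words one_braid_group braid_class_eq_iff)
  then show ?case using w by (auto simp: carrier_braid_group braid_word_inv_words)
qed (auto simp: carrier_braid_group one_braid_group mult_braid_class)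

lemma hurwitz_letter_tuples:
  assumes "group G" "Suc i < n" "gs \<in> tuples G n"
  shows "hurwitz_letter G (i, e) gs \<in> tuples G n"
proof -
  interpret group G by fact
  have "gs ! i \<in> carrier G" "gs ! Suc i \<in> carrier G" "set gs \<subseteq> carrier G" "length gs = n"
    using assms by (auto simp: tuples_def)
  then show ?thesis
    by (cases e) (auto simp: tuples_def dest!: subsetD[OF set_update_subset_insert])
qed

abbreviation "hurwitz_word G \<equiv> foldr (hurwitz_letter G)"

lemma hurwitz_word_tuples:
  assumes "group G"
  shows "w \<in> braid_words n \<Longrightarrow> gs \<in> tuples G n \<Longrightarrow> hurwitz_word G w gs \<in> tuples G n"
  by (induction w) (use hurwitz_letter_tuples[OF assms] in force)+

lemma hurwitz_word_cong:
  assumes "group G"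
  shows "braid_eq n v w \<Longrightarrow> gs \<in> tuples G n \<Longrightarrow> hurwitz_word G v gs = hurwitz_word G w gs"
proof (induction arbitrary: gs rule: braid_eq.induct)
  case (append u u' v v')
  then show ?case using hurwitz_word_tuples[OF assms] braid_eq_words by auto
next
  interpret group G by fact
  case (cancel i e)
  have g: "gs ! i \<in> carrier G" "gs ! Suc i \<in> carrier G" "length gs = n"
    using cancel by (auto simp: tuples_def)
  moreover have "x \<otimes>\<^bsub>G\<^esub> (inv\<^bsub>G\<^esub> x \<otimes>\<^bsub>G\<^esub> y) = y" "inv\<^bsub>G\<^esub> x \<otimes>\<^bsub>G\<^esub> (x \<otimes>\<^bsub>G\<^esub> y) = y"
    if "x \<in> carrier G" "y \<in> carrier G" for x y
    using that by (simp_all add: m_assoc[symmetric])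
  ultimately show ?case using cancel
    by (cases e) (auto simp: list_eq_iff_nth_eq nth_list_update m_assoc)
next
  case (far i j)
  then show ?case
    by (auto simp: list_eq_iff_nth_eq nth_list_update tuples_def)
next
  interpret group G by fact
  case (braid i)
  have g: "gs ! i \<in> carrier G" "gs ! Suc i \<in> carrier G" "gs ! Suc (Suc i) \<in> carrier G" "length gs = n"
    using braid by (auto simp: tuples_def)
  moreover have "x \<otimes>\<^bsub>G\<^esub> (inv\<^bsub>G\<^esub> x \<otimes>\<^bsub>G\<^esub> y) = y" "inv\<^bsub>G\<^esub> x \<otimes>\<^bsub>G\<^esub> (x \<otimes>\<^bsub>G\<^esub> y) = y"
    if "x \<in> carrier G" "y \<in> carrier G" for x y
    using that by (simp_all add: m_assoc[symmetric])
  ultimately show ?case using braid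
    by (auto simp: list_eq_iff_nth_eq nth_list_update m_assoc inv_mult_group)
qed auto

lemma hurwitz_class:
  assumes "group G" "w \<in> braid_words n" "gs \<in> tuples G n"
  shows "hurwitz G n (braid_class n w) gs = hurwitz_word G w gs"
proof -
  have "w \<in> braid_class n w" using assms by (auto simp: braid_class_def intro: braid_eq.refl)
  then have "braid_eq n w (SOME u. u \<in> braid_class n w)"
    using someI[of "\<lambda>u. u \<in> braid_class n w"] by (simp add: braid_class_def)
  from hurwitz_word_cong[OF assms(1) this assms(3)] show ?thesis
    using assms by (simp add: hurwitz_def)
qed

theorem hurwitz_action:
  assumes "group G"
  shows "group_action (braid_group n) (tuples G n) (hurwitz G n)"
proof -
  have comp: "hurwitz G n (x \<otimes>\<^bsub>braid_group n\<^esub> y) gs = hurwitz G n x (hurwitz G n y gs)"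
    if "x \<in> carrier (braid_group n)" "y \<in> carrier (braid_group n)" "gs \<in> tuples G n" for x y gs
    using that assms
    by (auto simp: carrier_braid_group mult_braid_class hurwitz_class hurwitz_word_tuples)
  have closed: "hurwitz G n x gs \<in> tuples G n"
    if "x \<in> carrier (braid_group n)" "gs \<in> tuples G n" for x gs
    using that assms by (auto simp: carrier_braid_group hurwitz_class hurwitz_word_tuples)
  have one: "hurwitz G n \<one>\<^bsub>braid_group n\<^esub> gs = gs" if "gs \<in> tuples G n" for gs
    using that assms by (simp add: one_braid_group hurwitz_class)
  interpret B: group "braid_group n" by (rule group_braid_group)
  have Bij: "hurwitz G n x \<in> Bij (tuples G n)" if x: "x \<in> carrier (braid_group n)" for x
  proof -
    have "bij_betw (hurwitz G n x) (tuples G n) (tuples G n)"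
      by (rule bij_betwI[where g = "hurwitz G n (inv\<^bsub>braid_group n\<^esub> x)"])
        (use x closed in \<open>auto simp: comp[symmetric] one\<close>)
    then show ?thesis by (simp add: Bij_def hurwitz_def)
  qed
  have "hurwitz G n \<in> hom (braid_group n) (BijGroup (tuples G n))"
  proof (rule homI)
    fix x y assume xy: "x \<in> carrier (braid_group n)" "y \<in> carrier (braid_group n)"
    show "hurwitz G n (x \<otimes>\<^bsub>braid_group n\<^esub> y) =
        hurwitz G n x \<otimes>\<^bsub>BijGroup (tuples G n)\<^esub> hurwitz G n y"
    proof (rule extensionalityI[where A = "tuples G n"])
      show "hurwitz G n (x \<otimes>\<^bsub>braid_group n\<^esub> y) \<in> extensional (tuples G n)"
        by (simp add: hurwitz_def)
      show "hurwitz G n x \<otimes>\<^bsub>BijGroup (tuples G n)\<^esub> hurwitz G n y \<in> extensional (tuples G n)"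
        using Bij xy by (simp add: BijGroup_def)
    qed (use Bij xy comp in \<open>auto simp: BijGroup_def compose_def\<close>)
  qed (use Bij in \<open>auto simp: BijGroup_def\<close>)
  then show ?thesis
    by (simp add: group_action_def group_hom_def group_hom_axioms_def group_BijGroup B.is_group)
qed


lemma hurwitz_orbit_eq:
  assumes "group G" "set gs \<subseteq> carrier G"
  shows "hurwitz_orbit G gs = {hurwitz_word G w gs | w. w \<in> braid_words (length gs)}"
proof -
  have "gs \<in> tuples G (length gs)" using assms by (simp add: tuples_def)
  then show ?thesis using assms
    by (simp add: hurwitz_orbit_def orbit_def carrier_braid_group)
      (auto simp: hurwitz_class; metis hurwitz_class imageI)
qed

lemma hurwitz_orbit_closed:
  assumes "group G" "set gs \<subseteq> carrier G" "hs \<in> hurwitz_orbit G gs"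
  shows "set hs \<subseteq> carrier G" "length hs = length gs"
proof -
  have "gs \<in> tuples G (length gs)" using assms by (simp add: tuples_def)
  with assms have "hs \<in> tuples G (length gs)"
    using hurwitz_word_tuples by (fastforce simp: hurwitz_orbit_eq)
  then show "set hs \<subseteq> carrier G" "length hs = length gs" by (auto simp: tuples_def)
qed

lemma hurwitz_orbit_refl:
  assumes "group G" "set gs \<subseteq> carrier G"
  shows "gs \<in> hurwitz_orbit G gs"
  using assms by (auto simp: hurwitz_orbit_eq intro!: exI[of _ "[]"])

lemma hurwitz_orbit_cong:
  assumes "group G" "set gs \<subseteq> carrier G" "hs \<in> hurwitz_orbit G gs"
  shows "hurwitz_orbit G hs = hurwitz_orbit G gs"
proof -
  note hs = hurwitz_orbit_closed[OF assms]
  interpret group_action "braid_group (length gs)" "tuples G (length gs)" "hurwitz G (length gs)"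
    by (rule hurwitz_action) fact
  have "x \<in> tuples G (length gs)" if "x \<in> hurwitz_orbit G gs" for x
    using hurwitz_orbit_closed[OF assms(1,2) that] by (simp add: tuples_def)
  moreover have "x \<in> tuples G (length gs)" if "x \<in> hurwitz_orbit G hs" for x
    using hurwitz_orbit_closed[OF assms(1) hs(1) that] hs by (simp add: tuples_def)
  moreover have "gs \<in> tuples G (length gs)" "hs \<in> tuples G (length gs)"
    using hs assms by (auto simp: tuples_def)
  ultimately show ?thesis
    using orbit_trans orbit_sym assms(3) hs(2) unfolding hurwitz_orbit_def
    by (metis (no_types, lifting) subset_antisym subsetI)
qed

lemma hurwitz_letter_length [simp]: "length (hurwitz_letter G p gs) = length gs"
  by (cases "(G, p, gs)" rule: hurwitz_letter.cases) auto

lemma hurwitz_word_length [simp]: "length (hurwitz_word G w gs) = length gs"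
  by (induction w) auto

lemma hurwitz_word_append1:
  "w \<in> braid_words (length gs) \<Longrightarrow> hurwitz_word G w (gs @ hs) = hurwitz_word G w gs @ hs"
proof (induction w)
  case (Cons p w)
  obtain i e where [simp]: "p = (i, e)" by (cases p)
  from Cons show ?case
    by (cases e) (auto simp: list_update_append nth_append)
qed simp

lemma hurwitz_word_append2:
  "w \<in> braid_words (length gs) \<Longrightarrow>
    hurwitz_word G (map (\<lambda>(i, e). (length hs + i, e)) w) (hs @ gs) = hs @ hurwitz_word G w gs"
proof (induction w)
  case (Cons p w)
  obtain i e where [simp]: "p = (i, e)" by (cases p)
  from Cons show ?case
    by (cases e) (auto simp: list_update_append nth_append)
qed simp

lemma hurwitz_orbit_append:
  assumes "group G" "set gs \<subseteq> carrier G" "set hs \<subseteq> carrier G"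
    and "gs' \<in> hurwitz_orbit G gs" "hs' \<in> hurwitz_orbit G hs"
  shows "hurwitz_orbit G (gs' @ hs') = hurwitz_orbit G (gs @ hs)"
proof -
  obtain v w where vw: "v \<in> braid_words (length gs)" "w \<in> braid_words (length hs)"
    "gs' = hurwitz_word G v gs" "hs' = hurwitz_word G w hs"
    using assms by (auto simp: hurwitz_orbit_eq)
  let ?w = "map (\<lambda>(i, e). (length gs + i, e)) w"
  have "hurwitz_word G (v @ ?w) (gs @ hs) = gs' @ hs'"
    using vw by (simp add: hurwitz_word_append1 hurwitz_word_append2)
  moreover have "v @ ?w \<in> braid_words (length (gs @ hs))"
    using vw by (auto simp: braid_words_def in_lists_conv_set; fastforce)
  ultimately have "gs' @ hs' \<in> {hurwitz_word G w (gs @ hs) | w. w \<in> braid_words (length (gs @ hs))}"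
    by (intro CollectI exI[of _ "v @ ?w"] conjI) (simp_all only:)
  moreover have "set (gs @ hs) \<subseteq> carrier G" using assms by simp
  ultimately have "gs' @ hs' \<in> hurwitz_orbit G (gs @ hs)"
    using hurwitz_orbit_eq[OF assms(1), of "gs @ hs"] by (simp only:)
  then show ?thesis using assms by (intro hurwitz_orbit_cong) auto
qed

lemma hurwitz_orbit_move:
  assumes "group G" "x \<in> carrier G" "set hs \<subseteq> carrier G"
  shows "hurwitz_orbit G (x # hs) =
    hurwitz_orbit G (map (\<lambda>h. x \<otimes>\<^bsub>G\<^esub> h \<otimes>\<^bsub>G\<^esub> inv\<^bsub>G\<^esub> x) hs @ [x])"
  using assms(3)
proof (induction hs)
  case (Cons h hs)
  interpret group G by fact
  let ?c = "\<lambda>h. x \<otimes>\<^bsub>G\<^esub> h \<otimes>\<^bsub>G\<^esub> inv\<^bsub>G\<^esub> x"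
  have c: "?c h # x # hs \<in> hurwitz_orbit G (x # h # hs)"
    using assms Cons.prems by (subst hurwitz_orbit_eq) (auto intro!: exI[of _ "[(0, True)]"])
  have "hurwitz_orbit G (x # h # hs) = hurwitz_orbit G ([?c h] @ (x # hs))"
    using hurwitz_orbit_cong[OF assms(1) _ c] assms Cons.prems by simp
  also have "\<dots> = hurwitz_orbit G ([?c h] @ (map ?c hs @ [x]))"
  proof (rule hurwitz_orbit_append)
    show "x # hs \<in> hurwitz_orbit G (map ?c hs @ [x])"
      using Cons assms hurwitz_orbit_refl[of G "x # hs"] by auto
    show "[?c h] \<in> hurwitz_orbit G [?c h]"
      using Cons assms by (intro hurwitz_orbit_refl) auto
  qed (use Cons assms in auto)
  finally show ?case by simp
qed (use assms in auto)

lemma tuple_prod_closed: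
  assumes "group G" "set gs \<subseteq> carrier G"
  shows "tuple_prod G gs \<in> carrier G"
proof -
  interpret group G by fact
  from assms(2) show ?thesis by (induction gs) (auto simp: tuple_prod_def)
qed

lemma hurwitz_orbit_swap:
  assumes "group G" "set gs \<subseteq> carrier G" "set hs \<subseteq> carrier G"
  shows "hurwitz_orbit G (gs @ hs) = hurwitz_orbit G
    (map (\<lambda>h. tuple_prod G gs \<otimes>\<^bsub>G\<^esub> h \<otimes>\<^bsub>G\<^esub> inv\<^bsub>G\<^esub> (tuple_prod G gs)) hs @ gs)"
  using assms(2)
proof (induction gs)
  case Nil
  interpret group G by fact
  have "map (\<lambda>h. \<one>\<^bsub>G\<^esub> \<otimes>\<^bsub>G\<^esub> h \<otimes>\<^bsub>G\<^esub> inv\<^bsub>G\<^esub> \<one>\<^bsub>G\<^esub>) hs = hs"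
    using assms by (intro map_idI) auto
  then show ?case by (simp add: tuple_prod_def)
next
  case (Cons g gs)
  interpret group G by fact
  let ?p = "tuple_prod G gs"
  let ?hs = "map (\<lambda>h. ?p \<otimes>\<^bsub>G\<^esub> h \<otimes>\<^bsub>G\<^esub> inv\<^bsub>G\<^esub> ?p) hs"
  let ?hs' = "map (\<lambda>h. g \<otimes>\<^bsub>G\<^esub> h \<otimes>\<^bsub>G\<^esub> inv\<^bsub>G\<^esub> g) ?hs"
  have p: "?p \<in> carrier G" using Cons.prems tuple_prod_closed assms(1) by auto
  have hs: "set ?hs \<subseteq> carrier G" using p assms by auto
  then have hs': "set ?hs' \<subseteq> carrier G" using Cons.prems by auto
  have "hurwitz_orbit G ([g] @ (gs @ hs)) = hurwitz_orbit G ([g] @ (?hs @ gs))"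
    by (rule hurwitz_orbit_append)
      (use Cons assms hs hurwitz_orbit_refl[of G "[g]"] hurwitz_orbit_refl[of G "gs @ hs"] in auto)
  also have "\<dots> = hurwitz_orbit G ((g # ?hs) @ gs)" by simp
  also have "\<dots> = hurwitz_orbit G ((?hs' @ [g]) @ gs)"
    by (rule hurwitz_orbit_append)
      (use Cons assms hs hs' hurwitz_orbit_move[of G g ?hs] hurwitz_orbit_refl[of G "g # ?hs"]
        hurwitz_orbit_refl[of G gs] in auto)
  also have "?hs' = map (\<lambda>h. tuple_prod G (g # gs) \<otimes>\<^bsub>G\<^esub> h \<otimes>\<^bsub>G\<^esub> inv\<^bsub>G\<^esub> (tuple_prod G (g # gs))) hs"
  proof -
    have pp: "tuple_prod G (g # gs) = g \<otimes>\<^bsub>G\<^esub> ?p" by (simp add: tuple_prod_def)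
    have "g \<otimes>\<^bsub>G\<^esub> (?p \<otimes>\<^bsub>G\<^esub> h \<otimes>\<^bsub>G\<^esub> inv\<^bsub>G\<^esub> ?p) \<otimes>\<^bsub>G\<^esub> inv\<^bsub>G\<^esub> g =
        g \<otimes>\<^bsub>G\<^esub> ?p \<otimes>\<^bsub>G\<^esub> h \<otimes>\<^bsub>G\<^esub> inv\<^bsub>G\<^esub> (g \<otimes>\<^bsub>G\<^esub> ?p)" if "h \<in> set hs" for h
      using that p Cons.prems assms by (auto simp: m_assoc inv_mult_group subset_iff)
    then show ?thesis unfolding pp by simp
  qed
  finally show ?case by simp
qed

lemma tuple_prod_append:
  assumes "group G" "set gs \<subseteq> carrier G" "set hs \<subseteq> carrier G"
  shows "tuple_prod G (gs @ hs) = tuple_prod G gs \<otimes>\<^bsub>G\<^esub> tuple_prod G hs"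
proof -
  interpret group G by fact
  from assms(2) show ?thesis
    using tuple_prod_closed[OF assms(1,3)] tuple_prod_closed[OF assms(1)]
    by (induction gs) (auto simp: tuple_prod_def m_assoc)
qed

lemma Comp_mult:
  assumes "group G" "set gs \<subseteq> carrier G" "set hs \<subseteq> carrier G"
  shows "hurwitz_orbit G gs \<otimes>\<^bsub>Comp G D \<xi>\<^esub> hurwitz_orbit G hs = hurwitz_orbit G (gs @ hs)"
proof -
  have "(\<Union>x\<in>hurwitz_orbit G gs. \<Union>y\<in>hurwitz_orbit G hs. hurwitz_orbit G (x @ y)) =
      (\<Union>x\<in>hurwitz_orbit G gs. \<Union>y\<in>hurwitz_orbit G hs. hurwitz_orbit G (gs @ hs))"
    by (intro SUP_cong HOL.refl hurwitz_orbit_append[OF assms])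
  also have "\<dots> = hurwitz_orbit G (gs @ hs)"
    using hurwitz_orbit_refl[OF assms(1,2)] hurwitz_orbit_refl[OF assms(1,3)] by auto
  finally show ?thesis by (simp add: Comp_def)
qed

lemma Comp_carrierE:
  assumes "m \<in> carrier (Comp G D \<xi>)"
  obtains gs n where "gs \<in> tuples G (n * (\<Sum>\<gamma>\<in>D. \<xi> \<gamma>))" "set gs \<subseteq> carrier G"
    "tuple_prod G gs = \<one>\<^bsub>G\<^esub>"
    "\<forall>\<gamma>\<in>D. length (filter (\<lambda>g. g \<in> \<gamma>) gs) = n * \<xi> \<gamma>" "m = hurwitz_orbit G gs"
  using assms by (auto simp: Comp_def components_def tuples_def)

theorem comm_monoid_Comp:
  assumes "group G"
  shows "comm_monoid (Comp G D \<xi>)"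
proof -
  interpret group G by fact
  let ?M = "Comp G D \<xi>"
  have one: "\<one>\<^bsub>?M\<^esub> = hurwitz_orbit G []" by (simp add: Comp_def)
  show ?thesis
  proof (rule comm_monoidI)
    fix x y assume x: "x \<in> carrier ?M" and y: "y \<in> carrier ?M"
    obtain gs n where gs: "gs \<in> tuples G (n * (\<Sum>\<gamma>\<in>D. \<xi> \<gamma>))" "set gs \<subseteq> carrier G"
      "tuple_prod G gs = \<one>\<^bsub>G\<^esub>"
      "\<forall>\<gamma>\<in>D. length (filter (\<lambda>g. g \<in> \<gamma>) gs) = n * \<xi> \<gamma>" "x = hurwitz_orbit G gs"
      using Comp_carrierE[OF x] by metis
    obtain hs k where hs: "hs \<in> tuples G (k * (\<Sum>\<gamma>\<in>D. \<xi> \<gamma>))" "set hs \<subseteq> carrier G"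
      "tuple_prod G hs = \<one>\<^bsub>G\<^esub>"
      "\<forall>\<gamma>\<in>D. length (filter (\<lambda>g. g \<in> \<gamma>) hs) = k * \<xi> \<gamma>" "y = hurwitz_orbit G hs"
      using Comp_carrierE[OF y] by metis
    have "gs @ hs \<in> tuples G ((n + k) * (\<Sum>\<gamma>\<in>D. \<xi> \<gamma>))"
      using gs hs by (auto simp: tuples_def algebra_simps)
    moreover have "tuple_prod G (gs @ hs) = \<one>\<^bsub>G\<^esub>"
      using gs hs assms by (simp add: tuple_prod_append)
    moreover have "\<forall>\<gamma>\<in>D. length (filter (\<lambda>g. g \<in> \<gamma>) (gs @ hs)) = (n + k) * \<xi> \<gamma>"
      using gs hs by (simp add: algebra_simps)
    ultimately have "hurwitz_orbit G (gs @ hs) \<in> components G D \<xi> (n + k)"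
      unfolding components_def by blast
    then show "x \<otimes>\<^bsub>?M\<^esub> y \<in> carrier ?M"
      using gs hs assms by (auto simp: Comp_mult) (auto simp: Comp_def)
    have "map (\<lambda>h. \<one>\<^bsub>G\<^esub> \<otimes>\<^bsub>G\<^esub> h \<otimes>\<^bsub>G\<^esub> inv\<^bsub>G\<^esub> \<one>\<^bsub>G\<^esub>) hs = hs"
      using hs by (intro map_idI) auto
    then show "x \<otimes>\<^bsub>?M\<^esub> y = y \<otimes>\<^bsub>?M\<^esub> x"
      using gs hs hurwitz_orbit_swap[OF assms gs(2) hs(2)] assms by (simp add: Comp_mult)
  next
    have "hurwitz_orbit G [] \<in> components G D \<xi> 0"
      by (auto simp: components_def tuples_def tuple_prod_def intro!: exI[of _ "[]"])
    then show "\<one>\<^bsub>?M\<^esub> \<in> carrier ?M" by (auto simp: Comp_def)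
  next
    fix x y z assume "x \<in> carrier ?M" "y \<in> carrier ?M" "z \<in> carrier ?M"
    then show "x \<otimes>\<^bsub>?M\<^esub> y \<otimes>\<^bsub>?M\<^esub> z = x \<otimes>\<^bsub>?M\<^esub> (y \<otimes>\<^bsub>?M\<^esub> z)"
      using assms by (elim Comp_carrierE) (simp add: Comp_mult)
  next
    fix x assume "x \<in> carrier ?M"
    then show "\<one>\<^bsub>?M\<^esub> \<otimes>\<^bsub>?M\<^esub> x = x"
      using assms by (elim Comp_carrierE) (simp add: Comp_mult one)
  qed
qed

lemma hurwitz_letter_generate:
  assumes "group G" "Suc i < length gs" "set gs \<subseteq> carrier G"
  shows "set (hurwitz_letter G (i, e) gs) \<subseteq> generate G (set gs)"
proof -
  interpret group G by fact
  have g: "gs ! i \<in> set gs" "gs ! Suc i \<in> set gs" using assms by auto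
  have gen: "set gs \<subseteq> generate G (set gs)" by (auto intro: generate.incl)
  have "gs ! i \<otimes>\<^bsub>G\<^esub> gs ! Suc i \<otimes>\<^bsub>G\<^esub> inv\<^bsub>G\<^esub> (gs ! i) \<in> generate G (set gs)"
    "inv\<^bsub>G\<^esub> (gs ! Suc i) \<otimes>\<^bsub>G\<^esub> gs ! i \<otimes>\<^bsub>G\<^esub> gs ! Suc i \<in> generate G (set gs)"
    using g by (auto intro: generate.eng generate.inv generate.incl)
  then show ?thesis using g gen
    by (cases e) (auto dest!: subsetD[OF set_update_subset_insert])
qed

lemma hurwitz_word_generate:
  assumes "group G" "set gs \<subseteq> carrier G"
  shows "w \<in> braid_words (length gs) \<Longrightarrow> set (hurwitz_word G w gs) \<subseteq> generate G (set gs)"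
proof (induction w)
  case (Cons p w)
  interpret group G by fact
  obtain i e where p [simp]: "p = (i, e)" by (cases p)
  let ?hs = "hurwitz_word G w gs"
  have "set ?hs \<subseteq> carrier G"
    using Cons generate_incl[OF assms(2)] by auto
  then have "set (hurwitz_letter G (i, e) ?hs) \<subseteq> generate G (set ?hs)"
    using Cons.prems assms by (intro hurwitz_letter_generate) auto
  also have "\<dots> \<subseteq> generate G (set gs)"
    using Cons assms by (intro generate_subgroup_incl generate_is_subgroup) auto
  finally show ?case by simp
qed (auto intro: generate.incl)

lemma comp_group_orbit:
  assumes "group G" "set gs \<subseteq> carrier G"
  shows "comp_group G (hurwitz_orbit G gs) = generate G (set gs)"
proof -
  interpret group G by fact
  have *: "generate G (set y) \<subseteq> generate G (set x)"
    if "set x \<subseteq> carrier G" "y \<in> hurwitz_orbit G x" for x y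
    using that assms(1) hurwitz_word_generate[OF assms(1), of x]
    by (intro generate_subgroup_incl generate_is_subgroup) (auto simp: hurwitz_orbit_eq)
  define hs where "hs = (SOME hs. hs \<in> hurwitz_orbit G gs)"
  have hs: "hs \<in> hurwitz_orbit G gs"
    unfolding hs_def using hurwitz_orbit_refl[OF assms] by (rule someI)
  then have "gs \<in> hurwitz_orbit G hs"
    using hurwitz_orbit_cong[OF assms hs] hurwitz_orbit_refl[OF assms] by simp
  with hs *[of gs hs] *[of hs gs] hurwitz_orbit_closed[OF assms hs] assms(2)
  show ?thesis unfolding comp_group_def hs_def[symmetric] by blast
qed

lemma monoid_ring_mult_superset:
  assumes "finite A" "Poly_Mapping.keys f \<subseteq> A" "finite B" "Poly_Mapping.keys f' \<subseteq> B"
  shows "f \<otimes>\<^bsub>monoid_ring M\<^esub> f' =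
    (\<Sum>a\<in>A. \<Sum>b\<in>B. Poly_Mapping.single (a \<otimes>\<^bsub>M\<^esub> b) (Poly_Mapping.lookup f a * Poly_Mapping.lookup f' b))"
proof -
  have "(\<Sum>b\<in>Poly_Mapping.keys f'. Poly_Mapping.single (a \<otimes>\<^bsub>M\<^esub> b) (Poly_Mapping.lookup f a * Poly_Mapping.lookup f' b))
    = (\<Sum>b\<in>B. Poly_Mapping.single (a \<otimes>\<^bsub>M\<^esub> b) (Poly_Mapping.lookup f a * Poly_Mapping.lookup f' b))" for a
    using assms by (intro sum.mono_neutral_left) (auto simp: in_keys_iff)
  moreover have "(\<Sum>a\<in>Poly_Mapping.keys f. \<Sum>b\<in>B. Poly_Mapping.single (a \<otimes>\<^bsub>M\<^esub> b) (Poly_Mapping.lookup f a * Poly_Mapping.lookup f' b))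
    = (\<Sum>a\<in>A. \<Sum>b\<in>B. Poly_Mapping.single (a \<otimes>\<^bsub>M\<^esub> b) (Poly_Mapping.lookup f a * Poly_Mapping.lookup f' b))"
    using assms by (intro sum.mono_neutral_left) (auto simp: in_keys_iff)
  ultimately show ?thesis by (simp add: monoid_ring_def)
qed

lemma monoid_ring_mult_add_left:
  "(f + g) \<otimes>\<^bsub>monoid_ring M\<^esub> h = f \<otimes>\<^bsub>monoid_ring M\<^esub> h + g \<otimes>\<^bsub>monoid_ring M\<^esub> h"
  using keys_add[of f g]
  by (simp add: monoid_ring_mult_superset[of "Poly_Mapping.keys f \<union> Poly_Mapping.keys g" _ "Poly_Mapping.keys h"]
      lookup_add distrib_right single_add sum.distrib)

lemma monoid_ring_mult_add_right:
  "h \<otimes>\<^bsub>monoid_ring M\<^esub> (f + g) = h \<otimes>\<^bsub>monoid_ring M\<^esub> f + h \<otimes>\<^bsub>monoid_ring M\<^esub> g"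
  using keys_add[of f g]
  by (simp add: monoid_ring_mult_superset[of "Poly_Mapping.keys h" _ "Poly_Mapping.keys f \<union> Poly_Mapping.keys g"]
      lookup_add distrib_left single_add sum.distrib)

lemma monoid_ring_mult_zero [simp]:
  "0 \<otimes>\<^bsub>monoid_ring M\<^esub> h = 0" "h \<otimes>\<^bsub>monoid_ring M\<^esub> 0 = 0"
  by (simp_all add: monoid_ring_def)

lemma monoid_ring_mult_sum_left:
  "(\<Sum>i\<in>I. f i) \<otimes>\<^bsub>monoid_ring M\<^esub> h = (\<Sum>i\<in>I. f i \<otimes>\<^bsub>monoid_ring M\<^esub> h)"
  by (induction I rule: infinite_finite_induct) (auto simp: monoid_ring_mult_add_left)

lemma monoid_ring_mult_sum_right:
  "h \<otimes>\<^bsub>monoid_ring M\<^esub> (\<Sum>i\<in>I. f i) = (\<Sum>i\<in>I. h \<otimes>\<^bsub>monoid_ring M\<^esub> f i)"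
  by (induction I rule: infinite_finite_induct) (auto simp: monoid_ring_mult_add_right)

lemma monoid_ring_mult_single:
  "Poly_Mapping.single a x \<otimes>\<^bsub>monoid_ring M\<^esub> Poly_Mapping.single b y = Poly_Mapping.single (a \<otimes>\<^bsub>M\<^esub> b) (x * y)"
  by (subst monoid_ring_mult_superset[of "{a}" _ "{b}"]) auto

lemma sum_single_lookup: "(\<Sum>a\<in>Poly_Mapping.keys f. Poly_Mapping.single a (Poly_Mapping.lookup f a)) = f"
  by (rule poly_mapping_eqI)
    (auto simp: lookup_sum lookup_single when_def sum.delta in_keys_iff cong: if_cong)

theorem cring_monoid_ring:
  assumes "comm_monoid M"
  shows "cring (monoid_ring M :: ('m \<Rightarrow>\<^sub>0 'k::comm_ring_1) ring)"
proof -
  interpret comm_monoid M by fact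
  let ?R = "monoid_ring M :: ('m \<Rightarrow>\<^sub>0 'k) ring"
  have carrier: "carrier ?R = {f. Poly_Mapping.keys f \<subseteq> carrier M}"
    and zero: "\<zero>\<^bsub>?R\<^esub> = 0" and one: "\<one>\<^bsub>?R\<^esub> = Poly_Mapping.single \<one>\<^bsub>M\<^esub> 1"
    and add: "f \<oplus>\<^bsub>?R\<^esub> g = f + g" for f g
    by (simp_all add: monoid_ring_def)
  show ?thesis
  proof (rule cringI)
    show "abelian_group ?R"
    proof (rule abelian_groupI)
      fix f g assume "f \<in> carrier ?R" "g \<in> carrier ?R"
      then show "f \<oplus>\<^bsub>?R\<^esub> g \<in> carrier ?R" using keys_add[of f g] by (auto simp: carrier add)
    next
      fix f assume "f \<in> carrier ?R"
      then show "\<exists>g\<in>carrier ?R. g \<oplus>\<^bsub>?R\<^esub> f = \<zero>\<^bsub>?R\<^esub>"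
        by (intro bexI[of _ "- f"]) (auto simp: carrier add zero in_keys_iff)
    qed (auto simp: carrier add zero algebra_simps)
    show "comm_monoid ?R"
    proof (rule comm_monoidI)
      fix f g assume fg: "f \<in> carrier ?R" "g \<in> carrier ?R"
      have "Poly_Mapping.keys (f \<otimes>\<^bsub>?R\<^esub> g) \<subseteq> (\<Union>a\<in>Poly_Mapping.keys f. \<Union>b\<in>Poly_Mapping.keys g. {a \<otimes>\<^bsub>M\<^esub> b})"
        unfolding monoid_ring_def
        by (simp, intro order.trans[OF keys_sum] UN_mono) (auto split: if_splits)
      then show "f \<otimes>\<^bsub>?R\<^esub> g \<in> carrier ?R" using fg by (force simp: carrier)
      have "f \<otimes>\<^bsub>?R\<^esub> g = (\<Sum>b\<in>Poly_Mapping.keys g. \<Sum>a\<in>Poly_Mapping.keys f.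
          Poly_Mapping.single (a \<otimes>\<^bsub>M\<^esub> b) (Poly_Mapping.lookup f a * Poly_Mapping.lookup g b))"
        unfolding monoid_ring_def by simp (rule sum.swap)
      also have "\<dots> = g \<otimes>\<^bsub>?R\<^esub> f"
        using fg unfolding monoid_ring_def
        by (auto intro!: sum.cong simp: m_comm subset_iff mult.commute)
      finally show "f \<otimes>\<^bsub>?R\<^esub> g = g \<otimes>\<^bsub>?R\<^esub> f" .
    next
      fix f g h assume fgh: "f \<in> carrier ?R" "g \<in> carrier ?R" "h \<in> carrier ?R"
      define S where "S = (\<lambda>f :: 'm \<Rightarrow>\<^sub>0 'k. \<Sum>a\<in>Poly_Mapping.keys f. Poly_Mapping.single a (Poly_Mapping.lookup f a))"
      have S: "S f = f" for f unfolding S_def by (rule sum_single_lookup)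
      have "S f \<otimes>\<^bsub>?R\<^esub> S g \<otimes>\<^bsub>?R\<^esub> S h = S f \<otimes>\<^bsub>?R\<^esub> (S g \<otimes>\<^bsub>?R\<^esub> S h)"
        using fgh unfolding S_def
        by (auto simp: monoid_ring_mult_sum_left monoid_ring_mult_sum_right monoid_ring_mult_single
            carrier m_assoc mult.assoc subset_iff intro!: sum.cong)
      then show "f \<otimes>\<^bsub>?R\<^esub> g \<otimes>\<^bsub>?R\<^esub> h = f \<otimes>\<^bsub>?R\<^esub> (g \<otimes>\<^bsub>?R\<^esub> h)" by (simp add: S)
    next
      fix f assume f: "f \<in> carrier ?R"
      have "\<one>\<^bsub>?R\<^esub> \<otimes>\<^bsub>?R\<^esub> f = (\<Sum>b\<in>Poly_Mapping.keys f. Poly_Mapping.single (\<one>\<^bsub>M\<^esub> \<otimes>\<^bsub>M\<^esub> b) (Poly_Mapping.lookup f b))"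
        unfolding one by (subst monoid_ring_mult_superset[of "{\<one>\<^bsub>M\<^esub>}" _ "Poly_Mapping.keys f"]) auto
      also have "\<dots> = (\<Sum>b\<in>Poly_Mapping.keys f. Poly_Mapping.single b (Poly_Mapping.lookup f b))"
        using f by (intro sum.cong) (auto simp: carrier)
      finally show "\<one>\<^bsub>?R\<^esub> \<otimes>\<^bsub>?R\<^esub> f = f" by (simp add: sum_single_lookup)
    qed (auto simp: carrier one)
  qed (simp add: add monoid_ring_mult_add_left)
qed

corollary cring_ring_of_components:
  assumes "group G"
  shows "cring (ring_of_components G D \<xi>)"
  using assms by (intro cring_monoid_ring comm_monoid_Comp)

end

theory Submission
  imports Defs
begin

text \<open>
  The components lying outside a prime ideal \<open>P\<close> form a submonoid. Since the group of a product
  contains the groups of its factors, and \<open>G\<close> is finite, one of these components has a group \<open>K\<close>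
  containing the groups of all the others. Each of the closed sets and strata in question consists
  of the \<open>P\<close> for which \<open>K\<close> satisfies an explicit condition; in particular \<open>P\<close> lies in the stratum
  of \<open>H'\<close> if and only if \<open>H' = K\<close>.
\<close>

lemma subgroup_comp_group:
  assumes "group G" "m \<in> carrier (Comp G D \<xi>)"
  shows "subgroup (comp_group G m) G"
  using assms(2)
proof (rule Comp_carrierE)
  fix gs assume "set gs \<subseteq> carrier G" "m = hurwitz_orbit G gs"
  then show ?thesis
    using assms(1) by (simp add: comp_group_orbit group.generate_is_subgroup)
qed

text \<open>Concatenating representing tuples of the factors represents the product, so its group is
  generated by the entries of both tuples.\<close>

lemma comp_group_mult:
  assumes "group G" "m \<in> carrier (Comp G D \<xi>)" "m' \<in> carrier (Comp G D \<xi>)"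
  shows "comp_group G m \<union> comp_group G m' \<subseteq> comp_group G (m \<otimes>\<^bsub>Comp G D \<xi>\<^esub> m')"
proof -
  interpret group G by fact
  obtain gs where gs: "set gs \<subseteq> carrier G" "m = hurwitz_orbit G gs"
    using assms(2) by (rule Comp_carrierE)
  obtain hs where hs: "set hs \<subseteq> carrier G" "m' = hurwitz_orbit G hs"
    using assms(3) by (rule Comp_carrierE)
  have "comp_group G (m \<otimes>\<^bsub>Comp G D \<xi>\<^esub> m') = generate G (set gs \<union> set hs)"
    using assms(1) gs hs by (simp add: Comp_mult comp_group_orbit)
  then show ?thesis
    using assms(1) gs hs mono_generate[of "set gs" "set gs \<union> set hs"]
      mono_generate[of "set hs" "set gs \<union> set hs"]
    by (simp add: comp_group_orbit)
qed

lemma monoid_ring_single_closed: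
  "a \<in> carrier M \<Longrightarrow> Poly_Mapping.single a x \<in> carrier (monoid_ring M)"
  by (simp add: monoid_ring_def)

text \<open>Scaling by \<open>c\<close> is multiplication by a ring element, which is why ideals of
  the monoid ring are closed under scalars.\<close>

lemma monoid_ring_mult_single_one:
  assumes "comm_monoid M" "f \<in> carrier (monoid_ring M)"
  shows "Poly_Mapping.single \<one>\<^bsub>M\<^esub> c \<otimes>\<^bsub>monoid_ring M\<^esub> f = pm_scale c f"
proof -
  interpret comm_monoid M by fact
  have "Poly_Mapping.single \<one>\<^bsub>M\<^esub> c \<otimes>\<^bsub>monoid_ring M\<^esub> f =
      Poly_Mapping.single \<one>\<^bsub>M\<^esub> c \<otimes>\<^bsub>monoid_ring M\<^esub>
        (\<Sum>b\<in>Poly_Mapping.keys f. Poly_Mapping.single b (Poly_Mapping.lookup f b))"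
    by (simp add: sum_single_lookup)
  also have "\<dots> = (\<Sum>b\<in>Poly_Mapping.keys f. Poly_Mapping.single b (c * Poly_Mapping.lookup f b))"
    using assms(2) unfolding monoid_ring_mult_sum_right
    by (intro sum.cong) (auto simp: monoid_ring_mult_single monoid_ring_def)
  also have "\<dots> = pm_scale c f"
    by (rule poly_mapping_eqI)
      (auto simp: lookup_sum lookup_single lookup_pm_scale when_def sum.delta in_keys_iff cong: if_cong)
  finally show ?thesis .
qed

text \<open>Links the two languages in use: primes are ring-theoretic ideals, whereas the ideals
  \<open>I\<close> and \<open>J\<close> are defined as linear spans.\<close>

lemma ideal_monoid_ring_subspace:
  assumes "comm_monoid M" "ideal P (monoid_ring M)"
  shows "pm.subspace P"
proof -
  interpret M: comm_monoid M by fact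
  interpret ideal P "monoid_ring M" by fact
  show ?thesis
  proof (rule pm.subspaceI)
    show "0 \<in> P" using additive_subgroup.zero_closed[OF additive_subgroup_axioms]
      by (simp add: monoid_ring_def)
    show "f + g \<in> P" if "f \<in> P" "g \<in> P" for f g
      using additive_subgroup.a_closed[OF additive_subgroup_axioms that] by (simp add: monoid_ring_def)
    show "pm_scale c f \<in> P" if "f \<in> P" for c f
      using I_l_closed[OF that monoid_ring_single_closed[OF M.one_closed, of c]] that
      by (simp add: monoid_ring_mult_single_one[OF assms(1)] Icarr)
  qed
qed

text \<open>A linear subspace contains a span as soon as it contains the spanning set. Lying in a
  zero locus thus becomes a condition on the components that \<open>P\<close> contains.\<close>

lemma component_span_subset_iff:
  assumes "group G" "ideal P (ring_of_components G D \<xi>)"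
  shows "component_span G D \<xi> Q \<subseteq> P \<longleftrightarrow>
    (\<forall>m\<in>carrier (Comp G D \<xi>). Q (comp_group G m) \<longrightarrow> Poly_Mapping.single m 1 \<in> P)"
proof -
  have "pm.subspace P"
    by (rule ideal_monoid_ring_subspace[OF comm_monoid_Comp[OF assms(1)] assms(2)])
  then have "pm.span B \<subseteq> P \<longleftrightarrow> B \<subseteq> P" for B
    using pm.span_minimal pm.span_superset[of B] by (metis order.trans)
  then show ?thesis
    unfolding component_span_def by auto
qed

lemma prime_largest_comp_group:
  fixes P :: "('g list set \<Rightarrow>\<^sub>0 'k::field) set"
  assumes "group G" "finite (carrier G)" "primeideal P (ring_of_components G D \<xi>)"
  obtains m where "m \<in> carrier (Comp G D \<xi>)" "Poly_Mapping.single m 1 \<notin> P"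
    "\<And>m'. m' \<in> carrier (Comp G D \<xi>) \<Longrightarrow> Poly_Mapping.single m' 1 \<notin> P \<Longrightarrow>
      comp_group G m' \<subseteq> comp_group G m"
proof -
  let ?M = "Comp G D \<xi>"
  interpret M: comm_monoid ?M by (rule comm_monoid_Comp) fact
  interpret primeideal P "ring_of_components G D \<xi>" by fact
  define S where "S = {m \<in> carrier ?M. Poly_Mapping.single m (1::'k) \<notin> P}"
  \<comment> \<open>A prime ideal is proper, so the identity component lies in \<open>S\<close>,
    which is therefore nonempty.\<close>
  have "\<one>\<^bsub>ring_of_components G D \<xi>\<^esub> \<notin> P"
    using one_imp_carrier I_notcarr by metis
  then have "\<one>\<^bsub>?M\<^esub> \<in> S"
    by (simp add: S_def) (simp add: monoid_ring_def)
  have sub: "comp_group G m \<subseteq> carrier G" if "m \<in> S" for m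
    using that subgroup.subset[OF subgroup_comp_group[OF assms(1)]] by (auto simp: S_def)
  \<comment> \<open>Finiteness of \<open>G\<close> gives the strict bound that guarantees a
    component in \<open>S\<close> whose group has greatest cardinality.\<close>
  then have "\<forall>m. m \<in> S \<longrightarrow> card (comp_group G m) < Suc (card (carrier G))"
    using assms(2) by (simp add: card_mono less_Suc_eq_le)
  with \<open>\<one>\<^bsub>?M\<^esub> \<in> S\<close> obtain m where m: "m \<in> S"
    and max: "\<forall>m'. m' \<in> S \<longrightarrow> card (comp_group G m') \<le> card (comp_group G m)"
    using ex_has_greatest_nat[of "\<lambda>m. m \<in> S" _ "\<lambda>m. card (comp_group G m)"] by metis
  have "comp_group G m' \<subseteq> comp_group G m" if m': "m' \<in> S" for m'
  proof -
    \<comment> \<open>This is where primality enters: if the product lay in \<open>P\<close>, so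
      would one of the factors.\<close>
    have mult: "m \<otimes>\<^bsub>?M\<^esub> m' \<in> S"
      using m m' I_prime[of "Poly_Mapping.single m 1" "Poly_Mapping.single m' 1"]
      by (auto simp: S_def monoid_ring_single_closed monoid_ring_mult_single)
    have le: "comp_group G m \<union> comp_group G m' \<subseteq> comp_group G (m \<otimes>\<^bsub>?M\<^esub> m')"
      using m m' comp_group_mult[OF assms(1)] by (simp add: S_def)
    \<comment> \<open>The group of the product contains that of \<open>m\<close> and, by maximality,
      has no larger cardinality. Equality forces the group of \<open>m'\<close> inside that of
      \<open>m\<close>.\<close>
    have "comp_group G m = comp_group G (m \<otimes>\<^bsub>?M\<^esub> m')"
      by (rule card_seteq)
        (use le max mult sub[OF mult] assms(2) in \<open>auto intro: finite_subset\<close>)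
    with le show ?thesis by blast
  qed
  with m that show thesis by (auto simp: S_def)
qed

text \<open>\<open>K\<close> is the largest group of a component outside \<open>P\<close>. The four
  conditions defining the spans all pass to larger groups. So if some spanning component lies
  outside \<open>P\<close>, then \<open>K\<close> satisfies the condition; conversely, if
  \<open>K\<close> does, then \<open>m\<close> itself is such a component.\<close>

lemma prime_strata:
  fixes P :: "('g list set \<Rightarrow>\<^sub>0 'k::field) set"
  assumes "group G" "finite (carrier G)" "P \<in> Spec (ring_of_components G D \<xi>)"
  obtains K where "subgroup K G"
    "\<And>H. P \<in> zero_locus (ring_of_components G D \<xi>) (ideal_I G D \<xi> H) \<longleftrightarrow> \<not> H \<subseteq> K"
    "\<And>H. P \<in> zero_locus (ring_of_components G D \<xi>) (ideal_I_star G D \<xi> H) \<longleftrightarrow> \<not> H \<subset> K"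
    "\<And>H. P \<in> zero_locus (ring_of_components G D \<xi>) (ideal_J G D \<xi> H) \<longleftrightarrow> K \<subset> H"
    "\<And>H. P \<in> zero_locus (ring_of_components G D \<xi>) (ideal_J_star G D \<xi> H) \<longleftrightarrow> K \<subseteq> H"
    "\<And>H. P \<in> stratum G D \<xi> H \<longleftrightarrow> H = K"
proof -
  have prime: "primeideal P (ring_of_components G D \<xi>)" using assms(3) by (simp add: Spec_def)
  then obtain m where m: "m \<in> carrier (Comp G D \<xi>)" "Poly_Mapping.single m 1 \<notin> P"
    and largest: "\<And>m'. m' \<in> carrier (Comp G D \<xi>) \<Longrightarrow> Poly_Mapping.single m' 1 \<notin> P \<Longrightarrow>
      comp_group G m' \<subseteq> comp_group G m"
    using prime_largest_comp_group[OF assms(1,2)] by metis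
  note span = component_span_subset_iff[OF assms(1) primeideal.axioms(1)[OF prime]]
  let ?K = "comp_group G m" and ?R = "ring_of_components G D \<xi> :: ('g list set \<Rightarrow>\<^sub>0 'k) ring"
  have I: "P \<in> zero_locus ?R (ideal_I G D \<xi> H) \<longleftrightarrow> \<not> H \<subseteq> ?K" for H
    using m largest assms(3) unfolding zero_locus_def ideal_I_def mem_Collect_eq span by blast
  have I_star: "P \<in> zero_locus ?R (ideal_I_star G D \<xi> H) \<longleftrightarrow> \<not> H \<subset> ?K" for H
    using m largest assms(3) unfolding zero_locus_def ideal_I_star_def mem_Collect_eq span by blast
  have J: "P \<in> zero_locus ?R (ideal_J G D \<xi> H) \<longleftrightarrow> ?K \<subset> H" for H
    using m largest assms(3) unfolding zero_locus_def ideal_J_def mem_Collect_eq span by blast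
  have J_star: "P \<in> zero_locus ?R (ideal_J_star G D \<xi> H) \<longleftrightarrow> ?K \<subseteq> H" for H
    using m largest assms(3) unfolding zero_locus_def ideal_J_star_def mem_Collect_eq span by blast
  \<comment> \<open>The two conditions are \<open>H \<subseteq> K\<close> and that \<open>H\<close>
    is not properly contained in \<open>K\<close>; together they say \<open>H = K\<close>.\<close>
  have "P \<in> stratum G D \<xi> H \<longleftrightarrow> H = ?K" for H
    unfolding stratum_def Diff_iff I I_star by blast
  then show thesis
    by (rule that[OF subgroup_comp_group[OF assms(1) m(1)] I I_star J J_star])
qed

text \<open>Handles the four equalities at once. Every prime lies in exactly one stratum, so it
  suffices to decide, for \<open>P\<close> in the stratum of \<open>K\<close>, whether
  \<open>P\<close> lies in the zero locus; \<open>char\<close> asks for just that.\<close>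

lemma is_disjoint_union_strata:
  fixes A :: "('g list set \<Rightarrow>\<^sub>0 'k::field) set"
  assumes "group G" "finite (carrier G)"
    and char: "\<And>P K. P \<in> Spec (ring_of_components G D \<xi>) \<Longrightarrow> subgroup K G \<Longrightarrow>
      P \<in> stratum G D \<xi> K \<Longrightarrow>
      P \<in> zero_locus (ring_of_components G D \<xi>) A \<longleftrightarrow> Q K"
  shows "is_disjoint_union (zero_locus (ring_of_components G D \<xi>) A) (stratum G D \<xi>)
    {K. subgroup K G \<and> Q K}"
proof -
  have spec: "P \<in> Spec (ring_of_components G D \<xi>)"
    if "P \<in> stratum G D \<xi> K \<or> P \<in> zero_locus (ring_of_components G D \<xi>) A"
    for P :: "('g list set \<Rightarrow>\<^sub>0 'k) set" and K
    using that by (auto simp: stratum_def zero_locus_def)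
  have ex: "\<exists>K. subgroup K G \<and> (\<forall>H. P \<in> stratum G D \<xi> H \<longleftrightarrow> H = K)"
    if "P \<in> Spec (ring_of_components G D \<xi>)" for P :: "('g list set \<Rightarrow>\<^sub>0 'k) set"
    using prime_strata[OF assms(1,2) that] by metis
  have "zero_locus (ring_of_components G D \<xi>) A = (\<Union>K\<in>{K. subgroup K G \<and> Q K}. stratum G D \<xi> K)"
  proof (intro equalityI subsetI)
    fix P assume P: "P \<in> zero_locus (ring_of_components G D \<xi>) A"
    then obtain K where "subgroup K G" "P \<in> stratum G D \<xi> K" using ex spec by metis
    with P show "P \<in> (\<Union>K\<in>{K. subgroup K G \<and> Q K}. stratum G D \<xi> K)"
      using char spec by blast
  next
    fix P :: "('g list set \<Rightarrow>\<^sub>0 'k) set"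
    assume "P \<in> (\<Union>K\<in>{K. subgroup K G \<and> Q K}. stratum G D \<xi> K)"
    then show "P \<in> zero_locus (ring_of_components G D \<xi>) A"
      using char spec by blast
  qed
  moreover have "disjoint_family_on (stratum G D \<xi> :: _ \<Rightarrow> ('g list set \<Rightarrow>\<^sub>0 'k) set set)
      {K. subgroup K G \<and> Q K}"
    unfolding disjoint_family_on_def using ex spec by (metis disjoint_iff)
  ultimately show ?thesis by (simp add: is_disjoint_union_def)
qed

theorem theorem3p9:
  fixes G :: "('g, 'x) monoid_scheme"
    and D :: "'g set set"
    and \<xi> :: "'g set \<Rightarrow> nat"
    and R :: "('g list set \<Rightarrow>\<^sub>0 'k::field) ring"
    and H :: "'g set"
  assumes "group G" and "finite (carrier G)"
    and "D \<noteq> {}" and "D \<subseteq> nontrivial_conjugacy_classes G"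
    and "\<forall>\<gamma>\<in>D. \<xi> \<gamma> > 0"
    and "\<not> CHAR('k) dvd order G"
    and "R = ring_of_components G D \<xi>"
    and "subgroup H G"
  shows "is_disjoint_union (zero_locus R (ideal_I G D \<xi> H)) (stratum G D \<xi>)
             {H'. subgroup H' G \<and> \<not> H \<subseteq> H'}
       \<and> is_disjoint_union (zero_locus R (ideal_I_star G D \<xi> H)) (stratum G D \<xi>)
             {H'. subgroup H' G \<and> \<not> H \<subset> H'}
       \<and> is_disjoint_union (zero_locus R (ideal_J G D \<xi> H)) (stratum G D \<xi>)
             {H'. subgroup H' G \<and> H' \<subset> H}
       \<and> is_disjoint_union (zero_locus R (ideal_J_star G D \<xi> H)) (stratum G D \<xi>)
             {H'. subgroup H' G \<and> H' \<subseteq> H}"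
  unfolding \<open>R = ring_of_components G D \<xi>\<close>
  \<comment> \<open>What remains for each equality is \<open>char\<close>. With the group attached
    to \<open>P\<close> at hand, lying in the stratum of \<open>K\<close> means that
    \<open>K\<close> is this group, and the matching zero locus criterion is then the claim.\<close>
  by (intro conjI is_disjoint_union_strata[OF assms(1,2)]; erule prime_strata[OF assms(1,2)]; simp)

end
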